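(* Let $G\subset\mathbb{Z}^d/(2\mathbb{Z}^d)$ be a separable group with $k$ generators, thus of order $2^k$. Let $g\in L^2(\mathbb{R}^d)$ and let $N$ be a subset of $\mathbb{Z}^d$ such that $|N\cap\mathrm{orbit}(x)|=1$ for all $x\in\mathbb{Z}^d$. For each $\gamma\in N$ set $c_\gamma=2^{-k}|\mathrm{orbit}(\gamma)|^{1/2}$, and consider the Wilson system $$\mathcal{W}(g,G)=\Big\{T_\lambda T_{\frac12h}\,c_\gamma\sum_{\sigma\in G}(-1)^{\langle I(h)+\gamma,\sigma\rangle}M_{R_\sigma\gamma}g\Big\}_{\lambda\in\mathbb{Z}^d,\ h\in G,\ \gamma\in N}.$$ Let $A\in\mathrm{Sp}(d)$ and let $\mu(A)$ be a unitary operator on $L^2(\mathbb{R}^d)$ such that $$\mu(A)\pi(\nu)=\varphi(A,\nu)\cdot\pi(A\nu)\mu(A)\quad\text{for all }\nu\in\mathbb{R}^{2d},$$ where $\varphi(A,\nu)\in\mathbb{C}$ and $|\varphi(A,\nu)|=1$. Then the symplectic Wilson system $$\mathcal{W}_s(g,G)=\Big\{\pi(A\lambda)\,\pi(A\lambda_h^* )\,c_\gamma\sum_{\sigma\in G}\varphi(A,\widetilde R_\sigma\gamma)(-1)^{\langle I(h)+\gamma,\sigma\rangle}\pi(A\widetilde R_\sigma\gamma)\mu(A)g\ :\ \lambda\in\mathbb{Z}^d\times\{0\}^d,\ h\in G,\ \gamma\in\{0\}^d\times N\Big\},$$ where $\lambda_h^*=\tfrac12h\times\{0\}^d$ for $h\in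 G$, is a [frame, Riesz basis, orthonormal basis] for $L^2(\mathbb{R}^d)$ if and only if the Wilson system $\mathcal{W}(g,G)$ has the same property. Moreover, the [frame, Riesz] bounds of the two systems are the same. (In both families, members that are the zero function are disregarded.)
   Context: Operators: $T_\lambda f(x)=f(x-\lambda)$, $M_\gamma f(x)=e^{2\pi i\langle x,\gamma\rangle}f(x)$ for $\lambda,\gamma\in\mathbb{R}^d$; $\pi(\nu)=M_\gamma T_\lambda$ for $\nu=(\lambda,\gamma)\in\mathbb{R}^d\times\mathbb{R}^d$. $\mathrm{Sp}(d)$ is the set of $A\in\mathrm{GL}_{\mathbb{R}}(2d)$ with $A^\top JA=J$, $J=\begin{bmatrix}0&I_d\\-I_d&0\end{bmatrix}$, $I_d$ the $d\times d$ identity. Reflections: for $\sigma\in\mathbb{Z}^d$, $R_\sigma x=((-1)^{\sigma_1}x_1,\dots,(-1)^{\sigma_d}x_d)$ on $\mathbb{R}^d$ and $\widetilde R_\sigma(x,\omega)=(R_\sigma x,R_\sigma\omega)$ on $\mathbb{R}^{2d}$. These depend only on $\sigma$ mod $2\mathbb{Z}^d$, so are defined for $\sigma\in\mathbb{Z}^d/(2\mathbb{Z}^d)$; elements of this group are identified with coset representatives in $\{0,1\}^d$. For a subgroup $G$, $\mathrm{orbit}(x)=\{R_\sigma x:\sigma\in G\}$. Separable groups: $[d]=\{1,\dots,d\}$, $\mathrm{supp}\,\sigma=\{i\in[d]:\sigma_i\equiv1\bmod2\}$. A subgroup $G\subset\mathbb{Z}^d/(2\mathbb{Z}^d)$ is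 separable if it has generators $\sigma^1,\dots,\sigma^k$ with non-empty supports $S_i=\mathrm{supp}\,\sigma^i$ that are pairwise disjoint. Dual group and $I$: let $\Lambda=\bigcup_{\sigma\in G}(\sigma+2\mathbb{Z}^d)$ and $\Lambda^\perp=\{\beta\in\mathbb{R}^d:\langle\beta,\lambda\rangle\in\mathbb{Z}\ \forall\lambda\in\Lambda\}$. The dual group $\widehat G$ is identified with $\mathbb{Z}^d/(2\Lambda^\perp)$ through the pairing $(-1)^{\langle\alpha,\sigma\rangle}$. $I:G\to\widehat G$ is the group isomorphism determined by $\langle I(\sigma^i),\sigma^j\rangle\equiv\delta_{i,j}\bmod2$; explicitly, choosing $n_i\in S_i$, $I(\sigma^i)$ is the class of the standard basis vector $\delta_{n_i}$. Elements of $\widehat G$ are identified with a fixed choice of representatives in $\mathbb{Z}^d$. In $\mathcal{W}_s(g,G)$, an element $\gamma=(0,\gamma')\in\{0\}^d\times N$ is identified with $\gamma'\in N$ in the expressions $c_\gamma$ and $\langle I(h)+\gamma,\sigma\rangle$. Frame theory: a countable family $\{f_j\}$ in $L^2(\mathbb{R}^d)$ is a frame with bounds $a,b>0$ if $a\|f\|^2\le\sum_j|\langle f,f_j\rangle|^2\le b\|f\|^2$ for all $f$; a Riesz basis with bounds $a,b>0$ if its span is dense and $a\sum|c_j|^2\le\|\sum c_jf_j\|^2\le b\sum|c_j|^2$ for all finitely supported $(c_j)$. *)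

theory Defs
  imports "HOL-Analysis.Analysis" "HOL-Algebra.Generated_Groups" "HOL-Number_Theory.Cong"
begin

section \<open>The Hilbert space of square-integrable functions\<close>

text \<open>Elements of \<open>L\<^sup>2\<close> are represented by functions; equality in \<open>L\<^sup>2\<close> is equality almost everywhere.\<close>

definition ae_eq :: "(real^'d \<Rightarrow> complex) \<Rightarrow> (real^'d \<Rightarrow> complex) \<Rightarrow> bool" where
  "ae_eq f g \<longleftrightarrow> (AE x in lebesgue. f x = g x)"

definition L2 :: "(real^'d \<Rightarrow> complex) set" where
  "L2 = {f. f \<in> borel_measurable lebesgue \<and> integrable lebesgue (\<lambda>x. (cmod (f x))\<^sup>2)}"

definition l2_inner :: "(real^'d \<Rightarrow> complex) \<Rightarrow> (real^'d \<Rightarrow> complex) \<Rightarrow> complex" where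
  "l2_inner f g = (LINT x|lebesgue. f x * cnj (g x))"

definition l2_norm :: "(real^'d \<Rightarrow> complex) \<Rightarrow> real" where
  "l2_norm f = sqrt (LINT x|lebesgue. (cmod (f x))\<^sup>2)"

text \<open>The second clause says that \<open>U\<close> descends to classes modulo almost everywhere equality.\<close>

definition unitary_on_L2 :: "((real^'d \<Rightarrow> complex) \<Rightarrow> real^'d \<Rightarrow> complex) \<Rightarrow> bool" where
  "unitary_on_L2 U \<longleftrightarrow>
     (\<forall>f\<in>L2. U f \<in> L2) \<and>
     (\<forall>f\<in>L2. \<forall>g\<in>L2. ae_eq f g \<longrightarrow> ae_eq (U f) (U g)) \<and>
     (\<forall>f\<in>L2. \<forall>g\<in>L2. \<forall>a b. ae_eq (U (\<lambda>x. a * f x + b * g x)) (\<lambda>x. a * U f x + b * U g x)) \<and>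
     (\<forall>f\<in>L2. \<forall>g\<in>L2. l2_inner (U f) (U g) = l2_inner f g) \<and>
     (\<forall>h\<in>L2. \<exists>f\<in>L2. ae_eq (U f) h)"


section \<open>Frames, Riesz bases and orthonormal bases\<close>

text \<open>A family is given by an index set \<open>J\<close> and a function \<open>F\<close> on it.\<close>

definition frame_with_bounds :: "real \<Rightarrow> real \<Rightarrow> 'j set \<Rightarrow> ('j \<Rightarrow> real^'d \<Rightarrow> complex) \<Rightarrow> bool" where
  "frame_with_bounds a b J F \<longleftrightarrow>
     0 < a \<and> 0 < b \<and> countable J \<and> (\<forall>j\<in>J. F j \<in> L2) \<and>
     (\<forall>f\<in>L2. (\<lambda>j. (cmod (l2_inner f (F j)))\<^sup>2) summable_on J \<and>
        a * (l2_norm f)\<^sup>2 \<le> (\<Sum>\<^sub>\<infinity>j\<in>J. (cmod (l2_inner f (F j)))\<^sup>2) \<and>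
        (\<Sum>\<^sub>\<infinity>j\<in>J. (cmod (l2_inner f (F j)))\<^sup>2) \<le> b * (l2_norm f)\<^sup>2)"

definition dense_span :: "'j set \<Rightarrow> ('j \<Rightarrow> real^'d \<Rightarrow> complex) \<Rightarrow> bool" where
  "dense_span J F \<longleftrightarrow>
     (\<forall>f\<in>L2. \<forall>\<epsilon>>0. \<exists>S c. finite S \<and> S \<subseteq> J \<and> l2_norm (\<lambda>x. f x - (\<Sum>j\<in>S. c j * F j x)) < \<epsilon>)"

definition riesz_with_bounds :: "real \<Rightarrow> real \<Rightarrow> 'j set \<Rightarrow> ('j \<Rightarrow> real^'d \<Rightarrow> complex) \<Rightarrow> bool" where
  "riesz_with_bounds a b J F \<longleftrightarrow>
     0 < a \<and> 0 < b \<and> countable J \<and> (\<forall>j\<in>J. F j \<in> L2) \<and> dense_span J F \<and>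
     (\<forall>S c. finite S \<and> S \<subseteq> J \<longrightarrow>
        a * (\<Sum>j\<in>S. (cmod (c j))\<^sup>2) \<le> (l2_norm (\<lambda>x. \<Sum>j\<in>S. c j * F j x))\<^sup>2 \<and>
        (l2_norm (\<lambda>x. \<Sum>j\<in>S. c j * F j x))\<^sup>2 \<le> b * (\<Sum>j\<in>S. (cmod (c j))\<^sup>2))"

definition is_frame :: "'j set \<Rightarrow> ('j \<Rightarrow> real^'d \<Rightarrow> complex) \<Rightarrow> bool" where
  "is_frame J F \<longleftrightarrow> (\<exists>a b. frame_with_bounds a b J F)"

definition is_riesz_basis :: "'j set \<Rightarrow> ('j \<Rightarrow> real^'d \<Rightarrow> complex) \<Rightarrow> bool" where
  "is_riesz_basis J F \<longleftrightarrow> (\<exists>a b. riesz_with_bounds a b J F)"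

definition is_orthonormal_basis :: "'j set \<Rightarrow> ('j \<Rightarrow> real^'d \<Rightarrow> complex) \<Rightarrow> bool" where
  "is_orthonormal_basis J F \<longleftrightarrow>
     (\<forall>j\<in>J. F j \<in> L2) \<and>
     (\<forall>i\<in>J. \<forall>j\<in>J. l2_inner (F i) (F j) = (if i = j then 1 else 0)) \<and>
     dense_span J F"

definition nonzero_indices :: "'j set \<Rightarrow> ('j \<Rightarrow> real^'d \<Rightarrow> complex) \<Rightarrow> 'j set" where
  "nonzero_indices J F = {j \<in> J. \<not> ae_eq (F j) (\<lambda>x. 0)}"


section \<open>Time-frequency shifts and symplectic matrices\<close>

text \<open>\<open>\<real>\<^sup>2\<^sup>d\<close> is indexed by the sum type \<open>'d + 'd\<close>: \<open>Inl\<close> for the first \<open>d\<close> coordinates,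
  \<open>Inr\<close> for the last \<open>d\<close>.\<close>

definition join :: "real^'d \<Rightarrow> real^'d \<Rightarrow> real^('d::finite + 'd)" where
  "join x w = (\<chi> i. case i of Inl a \<Rightarrow> x $ a | Inr b \<Rightarrow> w $ b)"

definition time_part :: "real^('d::finite + 'd) \<Rightarrow> real^'d" where
  "time_part v = (\<chi> i. v $ Inl i)"

definition freq_part :: "real^('d::finite + 'd) \<Rightarrow> real^'d" where
  "freq_part v = (\<chi> i. v $ Inr i)"

definition translation :: "real^'d \<Rightarrow> (real^'d \<Rightarrow> complex) \<Rightarrow> real^'d \<Rightarrow> complex" where
  "translation l f = (\<lambda>x. f (x - l))"

definition modulation :: "real^'d \<Rightarrow> (real^'d \<Rightarrow> complex) \<Rightarrow> real^'d \<Rightarrow> complex" where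
  "modulation w f = (\<lambda>x. exp (2 * complex_of_real pi * \<i> * complex_of_real (x \<bullet> w)) * f x)"

definition tf_shift :: "real^('d::finite + 'd) \<Rightarrow> (real^'d \<Rightarrow> complex) \<Rightarrow> real^'d \<Rightarrow> complex" where
  "tf_shift v f = modulation (freq_part v) (translation (time_part v) f)"

definition symplectic_J :: "real^('d::finite + 'd)^('d + 'd)" where
  "symplectic_J = (\<chi> i j. case (i, j) of
       (Inl a, Inr b) \<Rightarrow> (if a = b then 1 else 0)
     | (Inr a, Inl b) \<Rightarrow> (if a = b then - 1 else 0)
     | _ \<Rightarrow> 0)"

definition Sp :: "(real^('d::finite + 'd)^('d + 'd)) set" where
  "Sp = {A. invertible A \<and> transpose A ** symplectic_J ** A = symplectic_J}"


section \<open>Separable reflection groups and their duals\<close>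

definition real_vec :: "int^'d \<Rightarrow> real^'d" where
  "real_vec x = (\<chi> i. of_int (x $ i))"

definition int_inner :: "int^'d \<Rightarrow> int^'d \<Rightarrow> int" where
  "int_inner x y = (\<Sum>i\<in>UNIV. x $ i * y $ i)"

text \<open>\<open>\<int>\<^sup>d / 2\<int>\<^sup>d\<close>, with each coset identified with its representative in \<open>{0,1}\<^sup>d\<close>.\<close>

definition mod2_group :: "(int^'d) monoid" where
  "mod2_group = \<lparr>carrier = {x. \<forall>i. x $ i \<in> {0, 1}}, monoid.mult = (\<lambda>x y. \<chi> i. (x $ i + y $ i) mod 2), one = 0\<rparr>"

definition supp :: "int^'d \<Rightarrow> 'd set" where
  "supp \<sigma> = {i. [\<sigma> $ i = 1] (mod 2)}"

definition separable_with_generators :: "(int^'d) set \<Rightarrow> nat \<Rightarrow> (nat \<Rightarrow> int^'d) \<Rightarrow> bool" where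
  "separable_with_generators G k s \<longleftrightarrow>
     subgroup G mod2_group \<and>
     s ` {1..k} \<subseteq> carrier mod2_group \<and>
     G = generate mod2_group (s ` {1..k}) \<and>
     (\<forall>i\<in>{1..k}. supp (s i) \<noteq> {}) \<and>
     (\<forall>i\<in>{1..k}. \<forall>j\<in>{1..k}. i \<noteq> j \<longrightarrow> supp (s i) \<inter> supp (s j) = {})"

definition reflect :: "int^'d \<Rightarrow> real^'d \<Rightarrow> real^'d" where
  "reflect \<sigma> x = (\<chi> i. (- 1) powi (\<sigma> $ i) * x $ i)"

definition reflect2 :: "int^'d \<Rightarrow> real^('d::finite + 'd) \<Rightarrow> real^('d + 'd)" where
  "reflect2 \<sigma> v = join (reflect \<sigma> (time_part v)) (reflect \<sigma> (freq_part v))"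

definition reflection_orbit :: "(int^'d) set \<Rightarrow> real^'d \<Rightarrow> (real^'d) set" where
  "reflection_orbit G x = (\<lambda>\<sigma>. reflect \<sigma> x) ` G"

definition lattice_of :: "(int^'d) set \<Rightarrow> (int^'d) set" where
  "lattice_of G = (\<Union>\<sigma>\<in>G. range (\<lambda>z. \<sigma> + 2 *s z))"

definition dual_lattice :: "(int^'d) set \<Rightarrow> (real^'d) set" where
  "dual_lattice L = {\<beta>. \<forall>l\<in>L. \<beta> \<bullet> real_vec l \<in> \<int>}"

definition int_lattice :: "(int^'d) monoid" where
  "int_lattice = \<lparr>carrier = UNIV, monoid.mult = (+), one = 0\<rparr>"

text \<open>The quotient of \<open>\<int>\<^sup>d\<close> by twice the dual lattice. Restricting to integer vectors in the
  denominator loses nothing: the lattice contains \<open>2\<int>\<^sup>d\<close>, so twice its dual lies in \<open>\<int>\<^sup>d\<close>.\<close>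

definition dual_group :: "(int^'d) set \<Rightarrow> (int^'d) set monoid" where
  "dual_group G = int_lattice Mod {\<alpha>. \<exists>\<beta>\<in>dual_lattice (lattice_of G). real_vec \<alpha> = 2 *\<^sub>R \<beta>}"

text \<open>The pairing modulo 2 with an element of \<open>G\<close> is the same for all members \<open>\<alpha>\<close> of a class.\<close>

definition dual_isomorphism ::
    "(int^'d) set \<Rightarrow> nat \<Rightarrow> (nat \<Rightarrow> int^'d) \<Rightarrow> (int^'d \<Rightarrow> (int^'d) set) \<Rightarrow> bool" where
  "dual_isomorphism G k s I \<longleftrightarrow>
     I \<in> iso (mod2_group\<lparr>carrier := G\<rparr>) (dual_group G) \<and>
     (\<forall>i\<in>{1..k}. \<forall>j\<in>{1..k}. \<forall>\<alpha>\<in>I (s i). [int_inner \<alpha> (s j) = (if i = j then 1 else 0)] (mod 2))"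


section \<open>Wilson systems\<close>

definition wilson_coeff :: "(int^'d) set \<Rightarrow> nat \<Rightarrow> int^'d \<Rightarrow> real" where
  "wilson_coeff G k \<gamma> = sqrt (real (card (reflection_orbit G (real_vec \<gamma>)))) / 2 ^ k"

text \<open>Both systems are indexed by triples \<open>(l, h, \<gamma>)\<close> in \<open>\<int>\<^sup>d \<times> G \<times> N\<close>; \<open>I h\<close> below is an
  integer vector representing a class of the dual group.\<close>

definition wilson_index :: "(int^'d) set \<Rightarrow> (int^'d) set \<Rightarrow> ((int^'d) \<times> (int^'d) \<times> (int^'d)) set" where
  "wilson_index G N = UNIV \<times> G \<times> N"

definition wilson_system ::
    "(int^'d) set \<Rightarrow> nat \<Rightarrow> (int^'d \<Rightarrow> int^'d) \<Rightarrow> (real^'d \<Rightarrow> complex)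
     \<Rightarrow> (int^'d) \<times> (int^'d) \<times> (int^'d) \<Rightarrow> real^'d \<Rightarrow> complex" where
  "wilson_system G k I g = (\<lambda>(l, h, \<gamma>).
     translation (real_vec l) (translation ((1/2) *\<^sub>R real_vec h)
       (\<lambda>x. complex_of_real (wilson_coeff G k \<gamma>) *
          (\<Sum>\<sigma>\<in>G. (- 1) powi (int_inner (I h + \<gamma>) \<sigma>) *
             modulation (reflect \<sigma> (real_vec \<gamma>)) g x))))"

definition symplectic_wilson_system ::
    "(int^'d) set \<Rightarrow> nat \<Rightarrow> (int^'d \<Rightarrow> int^'d) \<Rightarrow> real^('d::finite + 'd)^('d + 'd)
     \<Rightarrow> ((real^'d \<Rightarrow> complex) \<Rightarrow> real^'d \<Rightarrow> complex) \<Rightarrow> (real^('d + 'd) \<Rightarrow> complex)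
     \<Rightarrow> (real^'d \<Rightarrow> complex) \<Rightarrow> (int^'d) \<times> (int^'d) \<times> (int^'d) \<Rightarrow> real^'d \<Rightarrow> complex" where
  "symplectic_wilson_system G k I A \<mu> \<phi> g = (\<lambda>(l, h, \<gamma>).
     tf_shift (A *v join (real_vec l) 0) (tf_shift (A *v join ((1/2) *\<^sub>R real_vec h) 0)
       (\<lambda>x. complex_of_real (wilson_coeff G k \<gamma>) *
          (\<Sum>\<sigma>\<in>G. \<phi> (reflect2 \<sigma> (join 0 (real_vec \<gamma>))) * (- 1) powi (int_inner (I h + \<gamma>) \<sigma>) *
             tf_shift (A *v reflect2 \<sigma> (join 0 (real_vec \<gamma>))) (\<mu> g) x))))"

end

theory Submission imports Defs begin

text \<open>
  The two systems are related by the unitary operator \<open>\<mu>\<close>: up to a factor of modulus one,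
  \<open>\<mu>\<close> maps the Wilson function with index \<open>j = (l, h, \<gamma>)\<close> to the symplectic Wilson function with the
  same index. Indeed a Wilson function is \<open>\<pi>(l, 0) \<pi>(h/2, 0)\<close> applied to a finite linear
  combination of the functions \<open>\<pi>(0, R\<^sub>\<sigma> \<gamma>) g\<close>. Pushing \<open>\<mu>\<close> through with the intertwining relation
  \<open>\<mu> \<pi>(\<nu>) = \<phi>(\<nu>) \<pi>(A \<nu>) \<mu>\<close> produces the inner factors \<open>\<phi>(0, R\<^sub>\<sigma> \<gamma>)\<close>, which depend on the
  summation variable and are written into the symplectic system, and the outer factor
  \<open>\<phi>(l, 0) \<phi>(h/2, 0)\<close>, which does not depend on it and is the phase relating the two systems
  (lemma \<open>wilson_intertwined\<close>).

  The properties in question are insensitive to both operations. A unitary operator preserves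
  inner products and is onto, and a phase leaves the modulus of an inner product
  alone, while in a linear combination it can be absorbed into the coefficients without changing
  their moduli. This is the content of the locale \<open>phase_intertwined\<close>, and it keeps all bounds.
  Since a unitary operator is injective, the members that vanish have the same indices in both
  families.

  As \<open>L\<^sup>2\<close> is represented by functions, every identity above holds almost everywhere, so the first part
  shows that the operations involved respect this equivalence.
\<close>

section \<open>Square-integrable functions modulo null sets\<close>

lemma ae_eq_refl [simp]: "ae_eq f f"
  by (simp add: ae_eq_def)

lemma ae_eq_sym: "ae_eq f g \<Longrightarrow> ae_eq g f"
  by (simp add: ae_eq_def eq_commute)

lemma ae_eq_trans [trans]: "ae_eq f g \<Longrightarrow> ae_eq g h \<Longrightarrow> ae_eq f h"
  unfolding ae_eq_def by (auto elim: eventually_elim2)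

lemma ae_eq_add: "ae_eq f f' \<Longrightarrow> ae_eq g g' \<Longrightarrow> ae_eq (\<lambda>x. f x + g x) (\<lambda>x. f' x + g' x)"
  unfolding ae_eq_def by (auto elim: eventually_elim2)

lemma ae_eq_diff: "ae_eq f f' \<Longrightarrow> ae_eq g g' \<Longrightarrow> ae_eq (\<lambda>x. f x - g x) (\<lambda>x. f' x - g' x)"
  unfolding ae_eq_def by (auto elim: eventually_elim2)

lemma ae_eq_cmult: "ae_eq f f' \<Longrightarrow> ae_eq (\<lambda>x. c * f x) (\<lambda>x. c * f' x)"
  unfolding ae_eq_def by (auto elim: eventually_mono)

lemma ae_eq_sum:
  "(\<And>i. i \<in> S \<Longrightarrow> ae_eq (f i) (f' i)) \<Longrightarrow> ae_eq (\<lambda>x. \<Sum>i\<in>S. f i x) (\<lambda>x. \<Sum>i\<in>S. f' i x)"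
  by (induction S rule: infinite_finite_induct) (simp_all add: ae_eq_add)

lemma L2_measurable [measurable_dest]: "f \<in> L2 \<Longrightarrow> f \<in> borel_measurable lebesgue"
  by (simp add: L2_def)

text \<open>Measurability passes to \<open>g\<close> because Lebesgue measure is complete.\<close>

lemma L2_ae_eq: "f \<in> L2 \<Longrightarrow> ae_eq f g \<Longrightarrow> g \<in> L2"
proof -
  assume f: "f \<in> L2" and ae: "ae_eq f g"
  have m: "g \<in> borel_measurable lebesgue"
    using borel_measurable_AE f ae unfolding L2_def ae_eq_def by blast
  have "integrable lebesgue (\<lambda>x. (cmod (g x))\<^sup>2)"
    by (rule integrable_cong_AE_imp[where g = "\<lambda>x. (cmod (f x))\<^sup>2"])
       (use f m ae in \<open>auto simp: L2_def ae_eq_def elim: eventually_mono\<close>)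
  with m show ?thesis by (simp add: L2_def)
qed

lemma L2_cmult: "f \<in> L2 \<Longrightarrow> (\<lambda>x. c * f x) \<in> L2"
  by (auto simp: L2_def norm_mult power_mult_distrib)

lemma L2_zero [simp]: "(\<lambda>x. 0) \<in> L2"
  by (simp add: L2_def)

lemma L2_add: 
  assumes f: "f \<in> L2" and g: "g \<in> L2" 
  shows "(\<lambda>x. f x + g x) \<in> L2"
proof -
  have m: "(\<lambda>x. f x + g x) \<in> borel_measurable lebesgue"
    using f g by (auto simp: L2_def)
  have "integrable lebesgue (\<lambda>x. (cmod (f x + g x))\<^sup>2)"
  proof (rule Bochner_Integration.integrable_bound)
    show "integrable lebesgue (\<lambda>x. 2 * (cmod (f x))\<^sup>2 + 2 * (cmod (g x))\<^sup>2)"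
      using f g by (auto simp: L2_def)
    have "(cmod (f x + g x))\<^sup>2 \<le> 2 * (cmod (f x))\<^sup>2 + 2 * (cmod (g x))\<^sup>2" for x
    proof -
      have "(cmod (f x + g x))\<^sup>2 \<le> (cmod (f x) + cmod (g x))\<^sup>2"
        by (intro power_mono norm_triangle_ineq) auto
      also have "\<dots> \<le> 2 * (cmod (f x))\<^sup>2 + 2 * (cmod (g x))\<^sup>2"
        using sum_squares_bound[of "cmod (f x)" "cmod (g x)"] by (simp add: power2_sum)
      finally show ?thesis .
    qed
    then show "AE x in lebesgue. norm ((cmod (f x + g x))\<^sup>2)
        \<le> norm (2 * (cmod (f x))\<^sup>2 + 2 * (cmod (g x))\<^sup>2)"
      by (intro AE_I2) simp
  qed (use m in measurable)
  with m show ?thesis by (simp add: L2_def)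
qed

lemma L2_diff: "f \<in> L2 \<Longrightarrow> g \<in> L2 \<Longrightarrow> (\<lambda>x. f x - g x) \<in> L2"
  using L2_add[of f "\<lambda>x. - 1 * g x"] L2_cmult[of g "- 1"] by simp

lemma L2_sum: "(\<And>i. i \<in> S \<Longrightarrow> f i \<in> L2) \<Longrightarrow> (\<lambda>x. \<Sum>i\<in>S. f i x) \<in> L2"
  by (induction S rule: infinite_finite_induct) (simp_all add: L2_add)

lemma l2_inner_ae_cong:
  assumes "f \<in> L2" "g \<in> L2" and f': "ae_eq f f'" and g': "ae_eq g g'"
  shows "l2_inner f g = l2_inner f' g'"
proof -
  have [measurable]: "f \<in> borel_measurable lebesgue" "g \<in> borel_measurable lebesgue"
    "f' \<in> borel_measurable lebesgue" "g' \<in> borel_measurable lebesgue"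
    using assms by (auto intro: L2_measurable L2_ae_eq)
  have cnj: "cnj \<in> borel_measurable borel"
    by (intro borel_measurable_continuous_onI continuous_intros)
  have [measurable]: "(\<lambda>x. cnj (g x)) \<in> borel_measurable lebesgue"
    "(\<lambda>x. cnj (g' x)) \<in> borel_measurable lebesgue"
    by (auto intro: measurable_compose[OF _ cnj])
  show ?thesis
    unfolding l2_inner_def
    by (rule integral_cong_AE) (use f' g' in \<open>auto simp: ae_eq_def elim: eventually_elim2\<close>)
qed

lemma l2_inner_cmult: "l2_inner (\<lambda>x. a * f x) (\<lambda>x. b * g x) = a * cnj b * l2_inner f g"
proof -
  have "(\<lambda>x. a * f x * cnj (b * g x)) = (\<lambda>x. (a * cnj b) * (f x * cnj (g x)))"
    by (simp add: fun_eq_iff mult_ac)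
  then show ?thesis by (simp add: l2_inner_def)
qed

text \<open>
  Through this formula, whatever is known about inner products carries over to norms.
\<close>

lemma l2_norm_conv_inner: "l2_norm f = sqrt (Re (l2_inner f f))"
proof -
  have "l2_inner f f = (LINT x|lebesgue. complex_of_real ((cmod (f x))\<^sup>2))"
    unfolding l2_inner_def by (simp only: complex_norm_square)
  also have "\<dots> = complex_of_real (LINT x|lebesgue. (cmod (f x))\<^sup>2)"
    by (rule integral_complex_of_real)
  finally show ?thesis by (simp add: l2_norm_def)
qed

lemma l2_norm_ae_cong: "f \<in> L2 \<Longrightarrow> ae_eq f f' \<Longrightarrow> l2_norm f = l2_norm f'"
  by (simp add: l2_norm_conv_inner l2_inner_ae_cong[of f f f' f'])

lemma l2_norm_eq_0_iff:
  assumes "f \<in> L2"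
  shows "l2_norm f = 0 \<longleftrightarrow> ae_eq f (\<lambda>x. 0)"
  using assms integral_nonneg_eq_0_iff_AE[of lebesgue "\<lambda>x. (cmod (f x))\<^sup>2"]
  by (simp add: L2_def l2_norm_def ae_eq_def)

section \<open>Time-frequency shifts on square-integrable functions\<close>

text \<open>
  Invariance of Lebesgue measure under translation, as the case of unit scaling of the
  affine change of variables.
\<close>

lemma
  fixes l :: "'a::euclidean_space"
  shows measurable_lebesgue_shift: "(\<lambda>x. x - l) \<in> lebesgue \<rightarrow>\<^sub>M lebesgue"
    and distr_lebesgue_shift: "distr lebesgue lebesgue (\<lambda>x. x - l) = lebesgue"
  using lebesgue_affine_measurable[of "\<lambda>_. 1" "- l"] lebesgue_affine_euclidean[of "\<lambda>_. 1" "- l"]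
  by (simp_all add: euclidean_representation density_1)

lemma L2_translation: 
  assumes "f \<in> L2"
  shows "translation l f \<in> L2"
proof -
  have "(\<lambda>x. f (x - l)) \<in> borel_measurable lebesgue"
    using measurable_compose[OF measurable_lebesgue_shift] assms L2_measurable by blast
  moreover have "integrable lebesgue (\<lambda>x. (cmod (f (x - l)))\<^sup>2)"
    using assms
    by (intro integrable_distr[OF measurable_lebesgue_shift]) (simp add: distr_lebesgue_shift L2_def)
  ultimately show ?thesis by (simp add: L2_def translation_def)
qed

lemma norm_modulation: "cmod (modulation w f x) = cmod (f x)"
  by (simp add: modulation_def norm_mult)

lemma L2_modulation: 
  assumes "f \<in> L2"
  shows "modulation w f \<in> L2"
proof -
  have "(\<lambda>x. exp (2 * complex_of_real pi * \<i> * complex_of_real (x \<bullet> w))) \<in> borel_measurable lebesgue"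
    by (intro measurable_completion) 
      (simp add: borel_measurable_continuous_onI continuous_intros)
  then have "modulation w f \<in> borel_measurable lebesgue"
    unfolding modulation_def using L2_measurable[OF assms] by (rule borel_measurable_times)
  with assms show ?thesis by (simp add: L2_def norm_modulation)
qed

lemma L2_tf_shift: "f \<in> L2 \<Longrightarrow> tf_shift v f \<in> L2"
  by (simp add: tf_shift_def L2_translation L2_modulation)

lemma ae_eq_tf_shift: 
  assumes "ae_eq f g"
  shows "ae_eq (tf_shift v f) (tf_shift v g)"
proof -
  have "AE x in lebesgue. f (x - time_part v) = g (x - time_part v)"
    using AE_distrD[OF measurable_lebesgue_shift, unfolded distr_lebesgue_shift] assms
    unfolding ae_eq_def .
  then show ?thesis
    by (auto simp: ae_eq_def tf_shift_def modulation_def translation_def elim: eventually_mono)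
qed

lemma tf_shift_cmult: "tf_shift v (\<lambda>x. c * f x) = (\<lambda>x. c * tf_shift v f x)"
  by (simp add: tf_shift_def modulation_def translation_def fun_eq_iff)

lemma time_part_join [simp]: "time_part (join l w) = l"
  by (simp add: time_part_def join_def vec_eq_iff)

lemma freq_part_join [simp]: "freq_part (join l w) = w"
  by (simp add: freq_part_def join_def vec_eq_iff)

lemma tf_shift_time: "tf_shift (join l 0) f = translation l f"
  by (simp add: tf_shift_def modulation_def)

lemma tf_shift_freq: "tf_shift (join 0 w) f = modulation w f"
  by (simp add: tf_shift_def translation_def)

section \<open>Unitary operators on square-integrable functions\<close>

lemma unitary_L2: "unitary_on_L2 U \<Longrightarrow> f \<in> L2 \<Longrightarrow> U f \<in> L2"
  by (simp add: unitary_on_L2_def)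

lemma unitary_cong: "unitary_on_L2 U \<Longrightarrow> f \<in> L2 \<Longrightarrow> g \<in> L2 \<Longrightarrow> ae_eq f g \<Longrightarrow> ae_eq (U f) (U g)"
  by (simp add: unitary_on_L2_def)

lemma unitary_lincomb:
  "unitary_on_L2 U \<Longrightarrow> f \<in> L2 \<Longrightarrow> g \<in> L2 \<Longrightarrow> 
    ae_eq (U (\<lambda>x. a * f x + b * g x)) (\<lambda>x. a * U f x + b * U g x)"
  by (simp add: unitary_on_L2_def)

lemma unitary_inner:
  "unitary_on_L2 U \<Longrightarrow> f \<in> L2 \<Longrightarrow> g \<in> L2 \<Longrightarrow> l2_inner (U f) (U g) = l2_inner f g"
  by (simp add: unitary_on_L2_def)

lemma unitary_surj:
  assumes "unitary_on_L2 U" "h \<in> L2"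
  obtains f where "f \<in> L2" "ae_eq (U f) h"
  using assms unfolding unitary_on_L2_def by blast

lemma unitary_norm: "unitary_on_L2 U \<Longrightarrow> f \<in> L2 \<Longrightarrow> l2_norm (U f) = l2_norm f"
  by (simp add: l2_norm_conv_inner unitary_inner)

lemma unitary_cmult: 
  "unitary_on_L2 U \<Longrightarrow> f \<in> L2 \<Longrightarrow> ae_eq (U (\<lambda>x. c * f x)) (\<lambda>x. c * U f x)"
  using unitary_lincomb[of U f "\<lambda>x. 0" c 0] by simp

lemma unitary_diff:
  "unitary_on_L2 U \<Longrightarrow> f \<in> L2 \<Longrightarrow> g \<in> L2 \<Longrightarrow> ae_eq (U (\<lambda>x. f x - g x)) (\<lambda>x. U f x - U g x)"
  using unitary_lincomb[of U f g 1 "- 1"] by simp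

text \<open>
  For infinite \<open>S\<close> both sums are zero by convention, so the same statement says that \<open>U\<close> maps
  zero to zero.
\<close>

lemma unitary_sum:
  assumes U: "unitary_on_L2 U" and "\<And>i. i \<in> S \<Longrightarrow> f i \<in> L2"
  shows "ae_eq (U (\<lambda>x. \<Sum>i\<in>S. f i x)) (\<lambda>x. \<Sum>i\<in>S. U (f i) x)"
  using assms(2)
proof (induction S rule: infinite_finite_induct)
  case (insert i S)
  have "ae_eq (U (\<lambda>x. f i x + (\<Sum>j\<in>S. f j x))) (\<lambda>x. U (f i) x + U (\<lambda>x. \<Sum>j\<in>S. f j x) x)"
    using unitary_lincomb[OF U, of "f i" "\<lambda>x. \<Sum>j\<in>S. f j x" 1 1] insert.prems 
    by (simp add: L2_sum)
  also have "ae_eq \<dots> (\<lambda>x. U (f i) x + (\<Sum>j\<in>S. U (f j) x))"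
    using insert by (intro ae_eq_add) auto
  finally show ?case using insert.hyps by simp
qed (use unitary_lincomb[OF U, of "\<lambda>x. 0" "\<lambda>x. 0" 0 0] in simp_all)

lemma unitary_ae_eq_0_iff:
  assumes "unitary_on_L2 U" "f \<in> L2"
  shows "ae_eq (U f) (\<lambda>x. 0) \<longleftrightarrow> ae_eq f (\<lambda>x. 0)"
  using assms by (simp flip: l2_norm_eq_0_iff add: unitary_L2 unitary_norm)

section \<open>Families that correspond under a unitary operator up to phases\<close>

lemma dense_spanE:
  assumes "dense_span J F" "f \<in> L2" "\<epsilon> > 0"
  obtains S c where "finite S" "S \<subseteq> J" "l2_norm (\<lambda>x. f x - (\<Sum>j\<in>S. c j * F j x)) < \<epsilon>"
  using assms unfolding dense_span_def by meson

text \<open>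
  The factor \<open>u\<close> is put on the side of \<open>F'\<close> because this is how the intertwining relation
  delivers it.
\<close>

locale phase_intertwined =
  fixes U :: "(real^'d \<Rightarrow> complex) \<Rightarrow> real^'d \<Rightarrow> complex"
    and J :: "'j set" and F F' :: "'j \<Rightarrow> real^'d \<Rightarrow> complex" and u :: "'j \<Rightarrow> complex"
  assumes unitary: "unitary_on_L2 U"
    and F_L2: "j \<in> J \<Longrightarrow> F j \<in> L2"
    and phase: "j \<in> J \<Longrightarrow> cmod (u j) = 1"
    and image: "j \<in> J \<Longrightarrow> ae_eq (U (F j)) (\<lambda>x. u j * F' j x)"
begin

text \<open>Used to discard the members that vanish.\<close>

lemma subfamily: "S \<subseteq> J \<Longrightarrow> phase_intertwined U S F F' u"
  using unitary F_L2 phase image by unfold_locales auto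

lemma phase_cnj [simp]: 
  assumes "j \<in> J" 
  shows "u j * cnj (u j) = 1" "cnj (u j) * u j = 1"
  using phase[OF assms] by (simp_all add: complex_norm_square[symmetric] mult.commute[of "cnj (u j)"])

lemma phase_nonzero [simp]: "j \<in> J \<Longrightarrow> u j \<noteq> 0"
  using phase by fastforce

lemma F'_L2: 
  assumes j: "j \<in> J" 
  shows "F' j \<in> L2"
proof -
  have "(\<lambda>x. u j * F' j x) \<in> L2"
    using L2_ae_eq[OF unitary_L2[OF unitary F_L2] image] j by blast
  then have "(\<lambda>x. cnj (u j) * (u j * F' j x)) \<in> L2"
    by (rule L2_cmult)
  then show ?thesis using j by (simp flip: mult.assoc)
qed

lemma nonzero_indices_eq: "nonzero_indices J F' = nonzero_indices J F"
proof -
  have "ae_eq (F' j) (\<lambda>x. 0) \<longleftrightarrow> ae_eq (F j) (\<lambda>x. 0)" if j: "j \<in> J" for j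
  proof -
    have "ae_eq (F' j) (\<lambda>x. 0) \<longleftrightarrow> ae_eq (\<lambda>x. u j * F' j x) (\<lambda>x. 0)"
      using j by (simp add: ae_eq_def)
    also have "\<dots> \<longleftrightarrow> ae_eq (U (F j)) (\<lambda>x. 0)"
      using image[OF j] by (blast intro: ae_eq_trans ae_eq_sym)
    also have "\<dots> \<longleftrightarrow> ae_eq (F j) (\<lambda>x. 0)"
      using unitary_ae_eq_0_iff[OF unitary F_L2[OF j]] .
    finally show ?thesis .
  qed
  then show ?thesis by (auto simp: nonzero_indices_def)
qed

lemma inner_F':
  assumes "i \<in> J" "j \<in> J"
  shows "l2_inner (F i) (F j) = u i * cnj (u j) * l2_inner (F' i) (F' j)"
proof -
  have "l2_inner (F i) (F j) = l2_inner (U (F i)) (U (F j))"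
    using assms by (simp add: unitary_inner[OF unitary] F_L2)
  also have "\<dots> = l2_inner (\<lambda>x. u i * F' i x) (\<lambda>x. u j * F' j x)"
    using assms by (intro l2_inner_ae_cong unitary_L2[OF unitary] F_L2 image)
  finally show ?thesis by (simp add: l2_inner_cmult)
qed

text \<open>
  A vector of \<open>L\<^sup>2\<close> is only almost everywhere equal to some \<open>U f\<close>, hence the second vector \<open>f'\<close>
  in this and the following lemmas.
\<close>

lemma coefficient_F':
  assumes f: "f \<in> L2" and f': "ae_eq (U f) f'" and j: "j \<in> J"
  shows "cmod (l2_inner f' (F' j)) = cmod (l2_inner f (F j))"
proof -
  have "l2_inner f (F j) = l2_inner (U f) (U (F j))"
    using f j by (simp add: unitary_inner[OF unitary] F_L2)
  also have "\<dots> = l2_inner (\<lambda>x. 1 * f' x) (\<lambda>x. u j * F' j x)"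
    using f j f' image by (intro l2_inner_ae_cong unitary_L2[OF unitary] F_L2) simp_all
  also have "\<dots> = cnj (u j) * l2_inner f' (F' j)"
    by (subst l2_inner_cmult) simp
  finally show ?thesis using phase[OF j] by (simp add: norm_mult)
qed

lemma norm_F':
  assumes f: "f \<in> L2" and f': "ae_eq (U f) f'"
  shows "l2_norm f' = l2_norm f"
  using l2_norm_ae_cong[OF unitary_L2[OF unitary f] f'] unitary_norm[OF unitary f] by simp

lemma frame_with_bounds_iff: "frame_with_bounds a b J F' \<longleftrightarrow> frame_with_bounds a b J F"
proof -
  let ?P = "\<lambda>f F. (\<lambda>j. (cmod (l2_inner f (F j)))\<^sup>2) summable_on J \<and>
        a * (l2_norm f)\<^sup>2 \<le> (\<Sum>\<^sub>\<infinity>j\<in>J. (cmod (l2_inner f (F j)))\<^sup>2) \<and>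
        (\<Sum>\<^sub>\<infinity>j\<in>J. (cmod (l2_inner f (F j)))\<^sup>2) \<le> b * (l2_norm f)\<^sup>2"
  have P: "?P f' F' \<longleftrightarrow> ?P f F" if "f \<in> L2" "ae_eq (U f) f'" for f f'
    using that by (simp add: coefficient_F' norm_F' cong: summable_on_cong infsum_cong)
  have "(\<forall>f\<in>L2. ?P f F') \<longleftrightarrow> (\<forall>f\<in>L2. ?P f F)"
  proof (intro iffI ballI)
    fix f :: "real^'d \<Rightarrow> complex" assume "\<forall>f\<in>L2. ?P f F'" "f \<in> L2"
    then show "?P f F" using P[of f "U f"] unitary_L2[OF unitary] by simp
  next
    fix f' :: "real^'d \<Rightarrow> complex" assume F: "\<forall>f\<in>L2. ?P f F" and "f' \<in> L2"
    then obtain f where f: "f \<in> L2" "ae_eq (U f) f'"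
      using unitary_surj[OF unitary] by blast
    then have "?P f F" using F by blast
    then show "?P f' F'" using P[OF f] by blast
  qed
  then show ?thesis by (simp add: frame_with_bounds_def F_L2 F'_L2)
qed

text \<open>
  The phases move into the coefficients. Both the density of the span and the Riesz
  inequalities rest on this, the latter with \<open>f = 0\<close>.
\<close>

lemma norm_residual:
  assumes f: "f \<in> L2" and f': "ae_eq (U f) f'" and S: "S \<subseteq> J"
  shows "l2_norm (\<lambda>x. f' x - (\<Sum>j\<in>S. (c j * u j) * F' j x))
       = l2_norm (\<lambda>x. f x - (\<Sum>j\<in>S. c j * F j x))"
proof (rule norm_F')
  have L2: "(\<lambda>x. c j * F j x) \<in> L2" if "j \<in> S" for j
    using that S by (auto intro: L2_cmult F_L2)
  show "(\<lambda>x. f x - (\<Sum>j\<in>S. c j * F j x)) \<in> L2"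
    using f by (intro L2_diff L2_sum L2)
  have image_c: "ae_eq (U (\<lambda>x. c j * F j x)) (\<lambda>x. (c j * u j) * F' j x)" if "j \<in> S" for j
  proof -
    have j: "j \<in> J" using that S by blast
    have "ae_eq (U (\<lambda>x. c j * F j x)) (\<lambda>x. c j * U (F j) x)"
      by (rule unitary_cmult[OF unitary F_L2[OF j]])
    also have "ae_eq \<dots> (\<lambda>x. c j * (u j * F' j x))"
      by (rule ae_eq_cmult[OF image[OF j]])
    finally show ?thesis by (simp add: mult.assoc)
  qed
  have "ae_eq (U (\<lambda>x. f x - (\<Sum>j\<in>S. c j * F j x)))
      (\<lambda>x. U f x - U (\<lambda>x. \<Sum>j\<in>S. c j * F j x) x)"
    using f by (intro unitary_diff[OF unitary] L2_sum L2)
  also have "ae_eq \<dots> (\<lambda>x. U f x - (\<Sum>j\<in>S. U (\<lambda>x. c j * F j x) x))"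
    by (intro ae_eq_diff ae_eq_refl unitary_sum[OF unitary] L2)
  also have "ae_eq \<dots> (\<lambda>x. f' x - (\<Sum>j\<in>S. (c j * u j) * F' j x))"
    by (intro ae_eq_diff f' ae_eq_sum image_c)
  finally show "ae_eq (U (\<lambda>x. f x - (\<Sum>j\<in>S. c j * F j x)))
      (\<lambda>x. f' x - (\<Sum>j\<in>S. (c j * u j) * F' j x))" .
qed

lemma norm_residual':
  assumes f: "f \<in> L2" and f': "ae_eq (U f) f'" and S: "S \<subseteq> J"
  shows "l2_norm (\<lambda>x. f' x - (\<Sum>j\<in>S. c j * F' j x))
       = l2_norm (\<lambda>x. f x - (\<Sum>j\<in>S. (c j * cnj (u j)) * F j x))"
proof -
  have "(\<Sum>j\<in>S. (c j * cnj (u j) * u j) * F' j x) = (\<Sum>j\<in>S. c j * F' j x)" for x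
    using S by (intro sum.cong) (auto simp: mult.assoc)
  then show ?thesis
    using norm_residual[OF assms, of "\<lambda>j. c j * cnj (u j)"] by simp
qed

lemma dense_span_iff: "dense_span J F' \<longleftrightarrow> dense_span J F"
proof
  assume F: "dense_span J F"
  show "dense_span J F'"
    unfolding dense_span_def
  proof (intro ballI allI impI)
    fix f' :: "real^'d \<Rightarrow> complex" and \<epsilon> :: real
    assume "f' \<in> L2" "\<epsilon> > 0"
    obtain f where f: "f \<in> L2" "ae_eq (U f) f'"
      using unitary_surj[OF unitary \<open>f' \<in> L2\<close>] by blast
    obtain S c where S: "finite S" "S \<subseteq> J" and 
      *: "l2_norm (\<lambda>x. f x - (\<Sum>j\<in>S. c j * F j x)) < \<epsilon>"
      by (rule dense_spanE[OF F f(1) \<open>\<epsilon> > 0\<close>])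
    have "l2_norm (\<lambda>x. f' x - (\<Sum>j\<in>S. (c j * u j) * F' j x)) < \<epsilon>"
      using * norm_residual[OF f S(2)] by simp
    with S show "\<exists>S c. finite S \<and> S \<subseteq> J \<and> l2_norm (\<lambda>x. f' x - (\<Sum>j\<in>S. c j * F' j x)) < \<epsilon>"
      by (intro exI[of _ S] exI[of _ "\<lambda>j. c j * u j"]) simp
  qed
next
  assume F': "dense_span J F'"
  show "dense_span J F"
    unfolding dense_span_def
  proof (intro ballI allI impI)
    fix f :: "real^'d \<Rightarrow> complex" and \<epsilon> :: real
    assume f: "f \<in> L2" and "\<epsilon> > 0"
    obtain S c where S: "finite S" "S \<subseteq> J" and 
      *: "l2_norm (\<lambda>x. U f x - (\<Sum>j\<in>S. c j * F' j x)) < \<epsilon>"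
      by (rule dense_spanE[OF F' unitary_L2[OF unitary f] \<open>\<epsilon> > 0\<close>])
    have "l2_norm (\<lambda>x. f x - (\<Sum>j\<in>S. (c j * cnj (u j)) * F j x)) < \<epsilon>"
      using * norm_residual'[OF f ae_eq_refl S(2)] by simp
    with S show "\<exists>S c. finite S \<and> S \<subseteq> J \<and> l2_norm (\<lambda>x. f x - (\<Sum>j\<in>S. c j * F j x)) < \<epsilon>"
      by (intro exI[of _ S] exI[of _ "\<lambda>j. c j * cnj (u j)"]) simp
  qed
qed

lemma norm_lincomb:
  assumes "S \<subseteq> J"
  shows "l2_norm (\<lambda>x. \<Sum>j\<in>S. (c j * u j) * F' j x) = l2_norm (\<lambda>x. \<Sum>j\<in>S. c j * F j x)"
    and "l2_norm (\<lambda>x. \<Sum>j\<in>S. c j * F' j x) = l2_norm (\<lambda>x. \<Sum>j\<in>S. (c j * cnj (u j)) * F j x)"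
proof -
  have minus: "l2_norm (\<lambda>x. 0 - f x) = l2_norm f" for f :: "real^'d \<Rightarrow> complex"
    by (simp add: l2_norm_def)
  have 0: "ae_eq (U (\<lambda>x. 0)) (\<lambda>x. 0)"
    using unitary_ae_eq_0_iff[OF unitary, of "\<lambda>x. 0"] by simp
  show "l2_norm (\<lambda>x. \<Sum>j\<in>S. (c j * u j) * F' j x) = l2_norm (\<lambda>x. \<Sum>j\<in>S. c j * F j x)"
    using norm_residual[OF _ 0 assms] by (simp only: minus L2_zero simp_thms)
  show "l2_norm (\<lambda>x. \<Sum>j\<in>S. c j * F' j x) = l2_norm (\<lambda>x. \<Sum>j\<in>S. (c j * cnj (u j)) * F j x)"
    using norm_residual'[OF _ 0 assms] by (simp only: minus L2_zero simp_thms)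
qed

lemma riesz_with_bounds_iff: "riesz_with_bounds a b J F' \<longleftrightarrow> riesz_with_bounds a b J F"
proof -
  define R where "R S c E \<longleftrightarrow>
      a * (\<Sum>j\<in>S. (cmod (c j))\<^sup>2) \<le> (l2_norm (\<lambda>x. \<Sum>j\<in>S. c j * E j x))\<^sup>2 \<and>
      (l2_norm (\<lambda>x. \<Sum>j\<in>S. c j * E j x))\<^sup>2 \<le> b * (\<Sum>j\<in>S. (cmod (c j))\<^sup>2)"
    for S c and E :: "'j \<Rightarrow> real^'d \<Rightarrow> complex"
  have moduli: "(\<Sum>j\<in>S. (cmod (c j * u j))\<^sup>2) = (\<Sum>j\<in>S. (cmod (c j))\<^sup>2)"
    "(\<Sum>j\<in>S. (cmod (c j * cnj (u j)))\<^sup>2) = (\<Sum>j\<in>S. (cmod (c j))\<^sup>2)" if "S \<subseteq> J" for S c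
    using that phase by (auto intro!: sum.cong simp: norm_mult)
  have to_F': "R S c F \<longleftrightarrow> R S (\<lambda>j. c j * u j) F'"
    and to_F: "R S c F' \<longleftrightarrow> R S (\<lambda>j. c j * cnj (u j)) F" if "S \<subseteq> J" for S c
    using that by (simp_all only: R_def moduli norm_lincomb)
  have "(\<forall>S c. finite S \<and> S \<subseteq> J \<longrightarrow> R S c F') \<longleftrightarrow> (\<forall>S c. finite S \<and> S \<subseteq> J \<longrightarrow> R S c F)"
  proof (intro iffI allI impI)
    fix S c assume "\<forall>S c. finite S \<and> S \<subseteq> J \<longrightarrow> R S c F'" and S: "finite S \<and> S \<subseteq> J"
    then have "R S (\<lambda>j. c j * u j) F'" by blast
    then show "R S c F" using S to_F' by blast
  next
    fix S c assume "\<forall>S c. finite S \<and> S \<subseteq> J \<longrightarrow> R S c F" and S: "finite S \<and> S \<subseteq> J"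
    then have "R S (\<lambda>j. c j * cnj (u j)) F" by blast
    then show "R S c F'" using S to_F by blast
  qed
  then show ?thesis by (simp add: riesz_with_bounds_def R_def F_L2 F'_L2 dense_span_iff)
qed

text \<open>
  Distinct members are orthogonal in one family iff in the other since the factor
  \<open>u i * cnj (u j)\<close> does not vanish; it equals one on the diagonal.
\<close>

lemma is_orthonormal_basis_iff: "is_orthonormal_basis J F' \<longleftrightarrow> is_orthonormal_basis J F"
proof -
  have "l2_inner (F' i) (F' j) = (if i = j then 1 else 0) \<longleftrightarrow>
      l2_inner (F i) (F j) = (if i = j then 1 else 0)" if "i \<in> J" "j \<in> J" for i j
    using inner_F'[OF that] that by simp
  then show ?thesis by (simp add: is_orthonormal_basis_def F_L2 F'_L2 dense_span_iff)
qed

lemma is_frame_iff: "is_frame J F' \<longleftrightarrow> is_frame J F"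
  by (simp add: is_frame_def frame_with_bounds_iff)

lemma is_riesz_basis_iff: "is_riesz_basis J F' \<longleftrightarrow> is_riesz_basis J F"
  by (simp add: is_riesz_basis_def riesz_with_bounds_iff)

end

section \<open>Wilson systems under an intertwining operator\<close>

lemma reflect2_freq: "reflect2 \<sigma> (join 0 w) = join 0 (reflect \<sigma> w)"
  by (simp add: reflect2_def) (simp add: reflect_def vec_eq_iff zero_vec_def)

text \<open>
  A single Wilson function. The inner phases match those of the symplectic system term by
  term, and the phases of the two time shifts factor out because time-frequency shifts are
  linear.
\<close>

lemma wilson_intertwined:
  fixes A :: "real^('d::finite + 'd)^('d + 'd)" and g :: "real^'d \<Rightarrow> complex"
  assumes g: "g \<in> L2" and \<mu>: "unitary_on_L2 \<mu>"
    and intertwine: "\<And>\<nu> f. f \<in> L2 \<Longrightarrow>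
      ae_eq (\<mu> (tf_shift \<nu> f)) (\<lambda>x. \<phi> \<nu> * tf_shift (A *v \<nu>) (\<mu> f) x)"
  shows "wilson_system G k I g (l, h, \<gamma>) \<in> L2"
    and "ae_eq (\<mu> (wilson_system G k I g (l, h, \<gamma>)))
      (\<lambda>x. \<phi> (join (real_vec l) 0) * \<phi> (join ((1/2) *\<^sub>R real_vec h) 0) *
        symplectic_wilson_system G k I A \<mu> \<phi> g (l, h, \<gamma>) x)"
proof -
  define c where "c = complex_of_real (wilson_coeff G k \<gamma>)"
  define \<epsilon> where "\<epsilon> \<sigma> = ((- 1) powi (int_inner (I h + \<gamma>) \<sigma>) :: complex)" for \<sigma>
  define v where "v \<sigma> = reflect2 \<sigma> (join 0 (real_vec \<gamma>))" for \<sigma>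
  define p where "p = (\<lambda>x. c * (\<Sum>\<sigma>\<in>G. \<epsilon> \<sigma> * tf_shift (v \<sigma>) g x))"
  define q where "q = (\<lambda>x. c * (\<Sum>\<sigma>\<in>G. \<phi> (v \<sigma>) * \<epsilon> \<sigma> * tf_shift (A *v v \<sigma>) (\<mu> g) x))"
  define a where "a = join (real_vec l) (0 :: real^'d)"
  define b where "b = join ((1/2) *\<^sub>R real_vec h) (0 :: real^'d)"

  have W: "wilson_system G k I g (l, h, \<gamma>) = tf_shift a (tf_shift b p)"
    by (simp add: wilson_system_def p_def v_def \<epsilon>_def c_def a_def b_def
        reflect2_freq tf_shift_time tf_shift_freq)
  have Ws: "symplectic_wilson_system G k I A \<mu> \<phi> g (l, h, \<gamma>) = tf_shift (A *v a) (tf_shift (A *v b) q)"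
    by (simp add: symplectic_wilson_system_def q_def v_def \<epsilon>_def c_def a_def b_def)

  have terms: "(\<lambda>x. \<epsilon> \<sigma> * tf_shift (v \<sigma>) g x) \<in> L2" for \<sigma>
    by (intro L2_cmult L2_tf_shift g)
  have p: "p \<in> L2"
    unfolding p_def by (intro L2_cmult L2_sum terms)
  then show "wilson_system G k I g (l, h, \<gamma>) \<in> L2"
    unfolding W by (intro L2_tf_shift)

  have term_image: "ae_eq (\<mu> (\<lambda>x. \<epsilon> \<sigma> * tf_shift (v \<sigma>) g x))
      (\<lambda>x. \<phi> (v \<sigma>) * \<epsilon> \<sigma> * tf_shift (A *v v \<sigma>) (\<mu> g) x)" for \<sigma>
  proof -
    have "ae_eq (\<mu> (\<lambda>x. \<epsilon> \<sigma> * tf_shift (v \<sigma>) g x)) (\<lambda>x. \<epsilon> \<sigma> * \<mu> (tf_shift (v \<sigma>) g) x)"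
      by (intro unitary_cmult[OF \<mu>] L2_tf_shift g)
    also have "ae_eq \<dots> (\<lambda>x. \<epsilon> \<sigma> * (\<phi> (v \<sigma>) * tf_shift (A *v v \<sigma>) (\<mu> g) x))"
      by (intro ae_eq_cmult intertwine g)
    finally show ?thesis by (simp add: mult_ac)
  qed
  have "ae_eq (\<mu> p) (\<lambda>x. c * \<mu> (\<lambda>x. \<Sum>\<sigma>\<in>G. \<epsilon> \<sigma> * tf_shift (v \<sigma>) g x) x)"
    unfolding p_def by (intro unitary_cmult[OF \<mu>] L2_sum terms)
  also have "ae_eq \<dots> (\<lambda>x. c * (\<Sum>\<sigma>\<in>G. \<mu> (\<lambda>x. \<epsilon> \<sigma> * tf_shift (v \<sigma>) g x) x))"
    by (intro ae_eq_cmult unitary_sum[OF \<mu>] terms)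
  also have "ae_eq \<dots> q"
    unfolding q_def by (intro ae_eq_cmult ae_eq_sum term_image)
  finally have pq: "ae_eq (\<mu> p) q" .

  have "ae_eq (\<mu> (tf_shift b p)) (\<lambda>x. \<phi> b * tf_shift (A *v b) (\<mu> p) x)"
    by (rule intertwine[OF p])
  also have "ae_eq \<dots> (\<lambda>x. \<phi> b * tf_shift (A *v b) q x)"
    by (intro ae_eq_cmult ae_eq_tf_shift pq)
  finally have bq: "ae_eq (\<mu> (tf_shift b p)) (\<lambda>x. \<phi> b * tf_shift (A *v b) q x)" .

  have "ae_eq (\<mu> (tf_shift a (tf_shift b p))) (\<lambda>x. \<phi> a * tf_shift (A *v a) (\<mu> (tf_shift b p)) x)"
    by (intro intertwine L2_tf_shift p)
  also have "ae_eq \<dots> (\<lambda>x. \<phi> a * tf_shift (A *v a) (\<lambda>x. \<phi> b * tf_shift (A *v b) q x) x)"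
    by (intro ae_eq_cmult ae_eq_tf_shift bq)
  finally show "ae_eq (\<mu> (wilson_system G k I g (l, h, \<gamma>)))
      (\<lambda>x. \<phi> (join (real_vec l) 0) * \<phi> (join ((1/2) *\<^sub>R real_vec h) 0) *
        symplectic_wilson_system G k I A \<mu> \<phi> g (l, h, \<gamma>) x)"
    by (simp add: W Ws tf_shift_cmult mult.assoc flip: a_def b_def)
qed

theorem proposition4p8:
  fixes G N :: "(int^'d) set" and k :: nat and s :: "nat \<Rightarrow> int^'d"
    and I :: "int^'d \<Rightarrow> (int^'d) set" and rep :: "(int^'d) set \<Rightarrow> int^'d"
    and g :: "real^'d \<Rightarrow> complex" and A :: "real^('d + 'd)^('d + 'd)"
    and \<mu> :: "(real^'d \<Rightarrow> complex) \<Rightarrow> real^'d \<Rightarrow> complex"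
    and \<phi> :: "real^('d + 'd) \<Rightarrow> complex"
  assumes "separable_with_generators G k s"
    and "dual_isomorphism G k s I"
    and "\<forall>C\<in>carrier (dual_group G). rep C \<in> C"
    and "g \<in> L2"
    and "\<forall>x :: int^'d. card (real_vec ` N \<inter> reflection_orbit G (real_vec x)) = 1"
    and "A \<in> Sp"
    and "unitary_on_L2 \<mu>"
    and "\<forall>\<nu>. cmod (\<phi> \<nu>) = 1"
    and "\<forall>\<nu>. \<forall>f\<in>L2. ae_eq (\<mu> (tf_shift \<nu> f)) (\<lambda>x. \<phi> \<nu> * tf_shift (A *v \<nu>) (\<mu> f) x)"
  defines "W \<equiv> wilson_system G k (\<lambda>h. rep (I h)) g"
    and "Ws \<equiv> symplectic_wilson_system G k (\<lambda>h. rep (I h)) A \<mu> \<phi> g"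
  defines "J \<equiv> nonzero_indices (wilson_index G N) W"
    and "Js \<equiv> nonzero_indices (wilson_index G N) Ws"
  shows "(is_frame Js Ws \<longleftrightarrow> is_frame J W) \<and>
    (is_riesz_basis Js Ws \<longleftrightarrow> is_riesz_basis J W) \<and>
    (is_orthonormal_basis Js Ws \<longleftrightarrow> is_orthonormal_basis J W) \<and>
    (\<forall>a b. frame_with_bounds a b Js Ws \<longleftrightarrow> frame_with_bounds a b J W) \<and>
    (\<forall>a b. riesz_with_bounds a b Js Ws \<longleftrightarrow> riesz_with_bounds a b J W)"
proof -
  define u where "u = (\<lambda>(l :: int^'d, h :: int^'d, \<gamma> :: int^'d).
    \<phi> (join (real_vec l) 0) * \<phi> (join ((1/2) *\<^sub>R real_vec h) 0))"
  interpret all: phase_intertwined \<mu> "wilson_index G N" W Ws u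
  proof
    fix j assume "j \<in> wilson_index G N"
    obtain l h \<gamma> where j: "j = (l, h, \<gamma>)" by (cases j)
    show "W j \<in> L2"
      unfolding j W_def using assms by (intro wilson_intertwined(1)) auto
    show "cmod (u j) = 1"
      using assms(8) by (simp add: j u_def norm_mult)
    show "ae_eq (\<mu> (W j)) (\<lambda>x. u j * Ws j x)"
      unfolding j W_def Ws_def u_def prod.case
      using assms by (intro wilson_intertwined(2)) auto
  qed (use assms in auto)
  have Js: "Js = J"
    by (simp add: Js_def J_def all.nonzero_indices_eq)
  interpret phase_intertwined \<mu> J W Ws u
    by (rule all.subfamily) (auto simp: J_def nonzero_indices_def)
  show ?thesis
    by (simp add: Js is_frame_iff is_riesz_basis_iff is_orthonormal_basis_iff
        frame_with_bounds_iff riesz_with_bounds_iff)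
qed

end
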